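(* Let $W$ and $\widetilde W$ be weight matrices of size $N$ on the same interval, with sequences of monic orthogonal polynomials $P_n$ and $\widetilde P_n$. Suppose $\widetilde W$ is a Darboux transformation of $W$, and let $D=\mathcal V\mathcal N\in\mathcal D(W)$ be a factorization realizing it, i.e. $\mathcal V,\mathcal N\in\operatorname{Mat}_N(\Omega[x])$ are degree-preserving and $P_n\cdot\mathcal V=A_n\widetilde P_n$ for all $n\in\mathbb N_0$, for some $A_n\in\operatorname{Mat}_N(\mathbb C)$. Then $$\mathcal V\,\mathcal D(\widetilde W)\,\mathcal N\subseteq\mathcal D(W)\qquad\text{and}\qquad \mathcal N\,\mathcal D(W)\,\mathcal V\subseteq\mathcal D(\widetilde W).$$
   Context: A weight matrix of size $N$ on an interval $\mathcal I=(x_0,x_1)$ is a smooth function $W:\mathcal I\to \operatorname{Mat}_N(\mathbb C)$, positive definite almost everywhere, with finite moments of all orders. Standing assumption: for each $n\ge 0$ the derivative $W^{(n)}(x)$ decreases exponentially at infinity and there is a scalar polynomial $p_n(x)$ such that $W^{(n)}(x)p_n(x)$ has finite moments. The monic orthogonal polynomials $P_n$ of $W$ are the unique sequence in $\operatorname{Mat}_N(\mathbb C)[x]$ with $P_n$ monic of degree $n$ (leading coefficient $I$) and $\int_{x_0}^{x_1} P_n(x)W(x)P_m(x)^*\,dx=0$ for $n\ne m$. Differential operators $D=\sum_{j}\partial^jF_j(x)$, $\partial=\frac{d}{dx}$, act on the right on matrix-valued functions: $P(x)\cdot D=\sum_j \partial^j(P)(x)F_j(x)$; the product satisfies $P\cdot(D_1D_2)=(P\cdot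 D_1)\cdot D_2$. $\operatorname{Mat}_N(\Omega[x])$ is the algebra of such operators with all $F_j\in\operatorname{Mat}_N(\mathbb C)[x]$. $\mathcal D(W)$ is the algebra of all $D\in\operatorname{Mat}_N(\Omega[x])$ such that for every $n\ge0$ there is $\Lambda_n(D)\in\operatorname{Mat}_N(\mathbb C)$ with $P_n\cdot D=\Lambda_n(D)P_n$. An operator $\mathcal V\in\operatorname{Mat}_N(\Omega[x])$ is degree-preserving if $\deg(P\cdot\mathcal V)=\deg P$ for all $P\in\operatorname{Mat}_N(\mathbb C)[x]$. The weight $\widetilde W$ is a Darboux transformation of $W$ if a factorization $D=\mathcal V\mathcal N\in\mathcal D(W)$ as described in the claim exists. *)

theory Defs
  imports
    "HOL-Analysis.Analysis"
    "HOL-Computational_Algebra.Polynomial"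
begin

section \<open>Matrix polynomials\<close>

text \<open>
  The algebra of matrix polynomials is represented by square matrices with polynomial
  entries. Throughout, the product of matrices is \<open>**\<close>; the operation \<open>*\<close> on nested
  vectors is componentwise and is never used.
\<close>

type_synonym 'n cmat = "complex ^ 'n ^ 'n"
type_synonym 'n matpoly = "complex poly ^ 'n ^ 'n"

definition const_mp :: "'n::finite cmat \<Rightarrow> 'n matpoly" where
  "const_mp A = map_matrix (\<lambda>c. [:c:]) A"

definition eval_mp :: "'n::finite matpoly \<Rightarrow> real \<Rightarrow> 'n cmat" where
  "eval_mp P x = map_matrix (\<lambda>p. poly p (of_real x)) P"

definition coeff_mp :: "'n::finite matpoly \<Rightarrow> nat \<Rightarrow> 'n cmat" where
  "coeff_mp P k = map_matrix (\<lambda>p. coeff p k) P"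

definition deriv_mp :: "'n::finite matpoly \<Rightarrow> 'n matpoly" where
  "deriv_mp P = map_matrix pderiv P"

text \<open>
  The zero polynomial must not have degree 0 here: otherwise an operator that annihilates
  some nonzero constant matrices could still count as degree-preserving.
\<close>

definition degree_mp :: "'n::finite matpoly \<Rightarrow> ereal" where
  "degree_mp P =
     (if P = 0 then -\<infinity> else ereal (of_nat (Max {degree (P $ i $ j) | i j. True})))"

definition monic_mp :: "nat \<Rightarrow> 'n::finite matpoly \<Rightarrow> bool" where
  "monic_mp n P \<longleftrightarrow> degree_mp P = ereal (of_nat n) \<and> coeff_mp P n = mat 1"


section \<open>Matrix differential operators with polynomial coefficients, acting on the right\<close>

text \<open>
  The operator \<open>\<Sum>j. \<partial>^j F\<^sub>j\<close> is represented by the finitely supported sequence of its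
  coefficients \<open>F\<^sub>j = coeff D j\<close>. Only the additive structure of the type \<^typ>\<open>'a poly\<close> is used;
  the product of operators is \<open>op_mult\<close>, not \<open>*\<close>.
\<close>

type_synonym 'n diffop = "'n matpoly poly"

definition act :: "'n::finite matpoly \<Rightarrow> 'n diffop \<Rightarrow> 'n matpoly" (infixl "\<cdot>\<^sub>r" 70) where
  "P \<cdot>\<^sub>r D = (\<Sum>j\<le>degree D. (deriv_mp ^^ j) P ** coeff D j)"

text \<open>
  For operators acting on the right the Leibniz rule reads
  \<open>F \<partial>^j = (\<Sum>k\<le>j. (j choose k) \<partial>^k F^(j-k))\<close>.
\<close>

definition op_mult :: "'n::finite diffop \<Rightarrow> 'n diffop \<Rightarrow> 'n diffop" (infixl "\<star>" 75) where
  "D \<star> E = (\<Sum>i\<le>degree D. \<Sum>j\<le>degree E. \<Sum>k\<le>j.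
      monom (map_matrix (smult (of_nat (j choose k)))
               ((deriv_mp ^^ (j - k)) (coeff D i) ** coeff E j)) (i + k))"

definition degree_preserving :: "'n::finite diffop \<Rightarrow> bool" where
  "degree_preserving D \<longleftrightarrow> (\<forall>P. degree_mp (P \<cdot>\<^sub>r D) = degree_mp P)"


subsection \<open>The product of operators is compatible with the action\<close>

lemma deriv_mp_funpow_nth [simp]: "(deriv_mp ^^ n) P $ i $ j = (pderiv ^^ n) (P $ i $ j)"
  by (induction n) (simp_all add: deriv_mp_def)

lemma deriv_mp_add: "deriv_mp (P + Q) = deriv_mp P + deriv_mp Q"
  by (simp add: deriv_mp_def vec_eq_iff pderiv_add)

lemma pderiv_sum': "pderiv (sum f A) = (\<Sum>i\<in>A. pderiv (f i :: 'a::{comm_semiring_1,semiring_no_zero_divisors} poly))"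
  by (induction A rule: infinite_finite_induct) (simp_all add: pderiv_add)

lemma deriv_mp_sum: "deriv_mp (sum f A) = (\<Sum>i\<in>A. deriv_mp (f i))"
  by (simp add: deriv_mp_def vec_eq_iff pderiv_sum')

lemma deriv_mp_funpow_sum: "(deriv_mp ^^ n) (sum f A) = (\<Sum>i\<in>A. (deriv_mp ^^ n) (f i))"
  by (induction n) (simp_all add: deriv_mp_sum)

lemma deriv_mp_mult: "deriv_mp (P ** Q) = deriv_mp P ** Q + P ** deriv_mp Q"
  by (simp add: deriv_mp_def vec_eq_iff matrix_matrix_mult_def pderiv_sum' pderiv_mult
      sum.distrib algebra_simps)

lemma pderiv_funpow_mult:
  fixes p q :: "complex poly"
  shows "(pderiv ^^ n) (p * q) =
    (\<Sum>k\<le>n. smult (of_nat (n choose k)) ((pderiv ^^ k) p * (pderiv ^^ (n - k)) q))"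
proof (induction n)
  case 0
  show ?case by simp
next
  case (Suc n)
  define a where "a = (\<lambda>k l. (pderiv ^^ k) p * (pderiv ^^ l) q)"
  have da: "pderiv (a k l) = a (Suc k) l + a k (Suc l)" for k l
    by (simp add: a_def pderiv_mult algebra_simps)
  have "(pderiv ^^ Suc n) (p * q) = pderiv (\<Sum>k\<le>n. smult (of_nat (n choose k)) (a k (n - k)))"
    using Suc by (simp add: a_def)
  also have "\<dots> = (\<Sum>k\<le>n. smult (of_nat (n choose k)) (a (Suc k) (n - k)))
      + (\<Sum>k\<le>n. smult (of_nat (n choose k)) (a k (Suc (n - k))))"
    by (simp add: pderiv_sum' pderiv_smult da smult_add_right sum.distrib)
  also have "(\<Sum>k\<le>n. smult (of_nat (n choose k)) (a k (Suc (n - k))))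
      = (\<Sum>k\<le>n. smult (of_nat (n choose k)) (a k (Suc n - k)))"
    by (intro sum.cong) (auto simp: Suc_diff_le)
  also have "\<dots> = (\<Sum>k\<le>Suc n. smult (of_nat (n choose k)) (a k (Suc n - k)))"
    by (simp add: binomial_eq_0)
  also have "\<dots> = a 0 (Suc n)
      + (\<Sum>k\<le>n. smult (of_nat (n choose Suc k)) (a (Suc k) (n - k)))"
    by (subst sum.atMost_Suc_shift) simp
  also have "(\<Sum>k\<le>n. smult (of_nat (n choose k)) (a (Suc k) (n - k)))
      + (a 0 (Suc n) + (\<Sum>k\<le>n. smult (of_nat (n choose Suc k)) (a (Suc k) (n - k))))
      = a 0 (Suc n) + (\<Sum>k\<le>n. smult (of_nat (Suc n choose Suc k)) (a (Suc k) (n - k)))"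
    by (simp add: smult_add_left sum.distrib algebra_simps)
  also have "\<dots> = (\<Sum>k\<le>Suc n. smult (of_nat (Suc n choose k)) (a k (Suc n - k)))"
    unfolding sum.atMost_Suc_shift[of _ n] by simp
  finally show ?case by (simp only: a_def)
qed

lemma smult_sum_right: "smult c (sum f A) = (\<Sum>i\<in>A. smult c (f i))"
  by (induction A rule: infinite_finite_induct) (simp_all add: smult_add_right)

lemma pderiv_funpow_sum: "(pderiv ^^ n) (sum f A) = (\<Sum>i\<in>A. (pderiv ^^ n) (f i :: complex poly))"
  by (induction n) (simp_all add: pderiv_sum')

lemma deriv_mp_funpow_mult:
  "(deriv_mp ^^ n) (P ** Q) = (\<Sum>k\<le>n. map_matrix (smult (of_nat (n choose k)))
      ((deriv_mp ^^ k) P ** (deriv_mp ^^ (n - k)) Q))"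
  by (simp add: vec_eq_iff matrix_matrix_mult_def pderiv_funpow_sum pderiv_funpow_mult
      smult_sum_right) (intro allI sum.swap)

lemma act_eq:
  assumes "degree D \<le> m"
  shows "P \<cdot>\<^sub>r D = (\<Sum>j\<le>m. (deriv_mp ^^ j) P ** coeff D j)"
  unfolding act_def using assms
  by (intro sum.mono_neutral_left)
    (auto simp: coeff_eq_0 matrix_matrix_mult_def vec_eq_iff)

lemma act_zero [simp]: "P \<cdot>\<^sub>r 0 = 0"
  by (simp add: act_def matrix_matrix_mult_def vec_eq_iff)

lemma act_add: "P \<cdot>\<^sub>r (D + E) = P \<cdot>\<^sub>r D + P \<cdot>\<^sub>r E"
proof -
  define m where "m = max (degree D) (degree E)"
  have "degree (D + E) \<le> m" "degree D \<le> m" "degree E \<le> m"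
    by (auto simp: m_def degree_add_le)
  thus ?thesis
    by (simp add: act_eq[of _ m] matrix_add_ldistrib sum.distrib)
qed

lemma act_sum: "P \<cdot>\<^sub>r (sum f A) = (\<Sum>i\<in>A. P \<cdot>\<^sub>r f i)"
  by (induction A rule: infinite_finite_induct) (simp_all add: act_add)

lemma act_monom: "P \<cdot>\<^sub>r monom F k = (deriv_mp ^^ k) P ** F"
proof -
  have "P \<cdot>\<^sub>r monom F k = (\<Sum>j\<le>k. (deriv_mp ^^ j) P ** coeff (monom F k) j)"
    by (intro act_eq) (simp add: degree_monom_le)
  also have "\<dots> = (\<Sum>j\<in>{k}. (deriv_mp ^^ j) P ** coeff (monom F k) j)"
    by (intro sum.mono_neutral_right)
      (auto simp: matrix_matrix_mult_def vec_eq_iff)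
  finally show ?thesis by simp
qed

lemma map_matrix_smult_mult:
  "(A :: 'n::finite matpoly) ** map_matrix (smult c) B = map_matrix (smult c) (A ** B)"
  "map_matrix (smult c) A ** B = map_matrix (smult c) (A ** B)"
  by (simp_all add: vec_eq_iff matrix_matrix_mult_def smult_sum_right)

lemma matrix_mult_sum_left: "(sum f S :: 'n::finite matpoly) ** B = (\<Sum>i\<in>S. f i ** B)"
  by (induction S rule: infinite_finite_induct)
    (simp_all add: matrix_matrix_mult_def vec_eq_iff algebra_simps sum.distrib)

theorem act_op_mult: "P \<cdot>\<^sub>r (D \<star> E) = (P \<cdot>\<^sub>r D) \<cdot>\<^sub>r E"
proof -
  have "P \<cdot>\<^sub>r (D \<star> E) = (\<Sum>i\<le>degree D. \<Sum>j\<le>degree E. \<Sum>k\<le>j.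
      map_matrix (smult (of_nat (j choose k)))
        ((deriv_mp ^^ (i + k)) P ** (deriv_mp ^^ (j - k)) (coeff D i)) ** coeff E j)"
    by (simp add: op_mult_def act_sum act_monom map_matrix_smult_mult matrix_mul_assoc)
  also have "\<dots> = (\<Sum>j\<le>degree E. \<Sum>i\<le>degree D. \<Sum>k\<le>j.
      map_matrix (smult (of_nat (j choose k)))
        ((deriv_mp ^^ (i + k)) P ** (deriv_mp ^^ (j - k)) (coeff D i)) ** coeff E j)"
    by (rule sum.swap)
  also have "\<dots> = (P \<cdot>\<^sub>r D) \<cdot>\<^sub>r E"
    unfolding act_def
    by (simp add: deriv_mp_funpow_sum deriv_mp_funpow_mult matrix_mult_sum_left
        funpow_add[symmetric] add.commute flip: comp_apply[of "deriv_mp ^^ _" "deriv_mp ^^ _"])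
  finally show ?thesis .
qed


section \<open>Weight matrices\<close>

definition ctransp :: "'n::finite cmat \<Rightarrow> 'n cmat" where
  "ctransp A = map_matrix cnj (transpose A)"

definition positive_definite :: "'n::finite cmat \<Rightarrow> bool" where
  "positive_definite A \<longleftrightarrow> ctransp A = A \<and>
     (\<forall>v. v \<noteq> 0 \<longrightarrow> 0 < Re (\<Sum>i\<in>UNIV. \<Sum>j\<in>UNIV. cnj (v $ i) * A $ i $ j * v $ j))"

definition nth_deriv :: "nat \<Rightarrow> (real \<Rightarrow> 'n::finite cmat) \<Rightarrow> real \<Rightarrow> 'n cmat" where
  "nth_deriv n W = ((\<lambda>f x. vector_derivative f (at x)) ^^ n) W"

definition smooth_on_interval :: "ereal \<Rightarrow> ereal \<Rightarrow> (real \<Rightarrow> 'n::finite cmat) \<Rightarrow> bool" where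
  "smooth_on_interval x0 x1 W \<longleftrightarrow>
     (\<forall>n. \<forall>x\<in>einterval x0 x1. nth_deriv n W differentiable (at x))"

definition finite_moments :: "ereal \<Rightarrow> ereal \<Rightarrow> (real \<Rightarrow> 'n::finite cmat) \<Rightarrow> bool" where
  "finite_moments x0 x1 W \<longleftrightarrow>
     (\<forall>k::nat. set_integrable lborel (einterval x0 x1) (\<lambda>x. x ^ k *\<^sub>R W x))"

text \<open>Vacuous (choose \<open>R\<close> large) if the interval is bounded.\<close>

definition exp_decreasing :: "ereal \<Rightarrow> ereal \<Rightarrow> (real \<Rightarrow> 'n::finite cmat) \<Rightarrow> bool" where
  "exp_decreasing x0 x1 W \<longleftrightarrow>
     (\<exists>c>0. \<exists>C R. \<forall>x\<in>einterval x0 x1. R \<le> \<bar>x\<bar> \<longrightarrow> norm (W x) \<le> C * exp (- c * \<bar>x\<bar>))"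

text \<open>
  The derivatives of \<open>W\<close> need not have finite moments at finite endpoints of the interval,
  hence the polynomial factor \<open>p\<close>; without \<open>p \<noteq> 0\<close> that condition would be void.
\<close>

definition weight_matrix :: "ereal \<Rightarrow> ereal \<Rightarrow> (real \<Rightarrow> 'n::finite cmat) \<Rightarrow> bool" where
  "weight_matrix x0 x1 W \<longleftrightarrow>
     x0 < x1 \<and>
     smooth_on_interval x0 x1 W \<and>
     (AE x in lborel. x \<in> einterval x0 x1 \<longrightarrow> positive_definite (W x)) \<and>
     finite_moments x0 x1 W \<and>
     (\<forall>n. exp_decreasing x0 x1 (nth_deriv n W)) \<and>
     (\<forall>n. \<exists>p :: complex poly. p \<noteq> 0 \<and>
        finite_moments x0 x1 (\<lambda>x. map_matrix (\<lambda>w. poly p (of_real x) * w) (nth_deriv n W x)))"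


section \<open>Orthogonal polynomials and the algebra of a weight\<close>

definition monic_orthogonal_polys ::
  "ereal \<Rightarrow> ereal \<Rightarrow> (real \<Rightarrow> 'n::finite cmat) \<Rightarrow> (nat \<Rightarrow> 'n matpoly) \<Rightarrow> bool" where
  "monic_orthogonal_polys x0 x1 W P \<longleftrightarrow>
     (\<forall>n. monic_mp n (P n)) \<and>
     (\<forall>n m. n \<noteq> m \<longrightarrow>
        set_lebesgue_integral lborel (einterval x0 x1)
          (\<lambda>x. eval_mp (P n) x ** W x ** ctransp (eval_mp (P m) x)) = 0)"

text \<open>
  The quantifier over \<open>P\<close> only names the monic orthogonal polynomials of \<open>W\<close>: a weight
  matrix has exactly one such sequence.
\<close>

definition diffop_algebra ::
  "ereal \<Rightarrow> ereal \<Rightarrow> (real \<Rightarrow> 'n::finite cmat) \<Rightarrow> 'n diffop set" where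
  "diffop_algebra x0 x1 W =
     {D. \<exists>P. monic_orthogonal_polys x0 x1 W P \<and>
             (\<forall>n. \<exists>\<Lambda>. P n \<cdot>\<^sub>r D = const_mp \<Lambda> ** P n)}"

end

theory Submission
  imports Defs
begin

text \<open>
  Since the operators act on the right, they commute with left multiplication by constant
  matrices (\<open>act_const_mult\<close>). Hence an operator that carries each member of one sequence of matrix
  polynomials to a constant left multiple of the member of another sequence with the same index
  composes with others of this kind by multiplying the constants. By hypothesis \<open>V\<close> carries
  \<open>P n\<close> to \<open>A n\<close> times \<open>Pt n\<close>; what has to be found is that \<open>N\<close> goes back,
  that is, carries \<open>Pt n\<close> to a constant multiple of \<open>P n\<close>.

  This holds because \<open>A n\<close> is invertible. If \<open>C\<close> is a constant matrix with \<open>C ** A n = 0\<close>,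
  then \<open>V\<close> annihilates \<open>C\<close> times \<open>P n\<close>; as \<open>V\<close> preserves degrees, that product is zero, and its
  leading coefficient is \<open>C\<close> (\<open>degree_preserving_leading_invertible\<close>). So \<open>Pt n\<close> is a constant
  multiple of \<open>P n \<cdot>\<^sub>r V\<close>, which \<open>N\<close> carries to \<open>P n \<cdot>\<^sub>r D\<close>, a constant multiple of
  \<open>P n\<close>. Now \<open>V \<star> E \<star> N\<close> and \<open>N \<star> E \<star> V\<close> run around the loop between the two
  sequences, with an eigenoperator \<open>E\<close> in the middle.

  Membership in \<open>diffop_algebra\<close> only provides eigenvalues for some monic orthogonal sequence,
  so the argument also rests on uniqueness (\<open>monic_orthogonal_polys_unique\<close>): the difference of two
  candidates of degree \<open>n\<close> has lower degree, is therefore orthogonal to both, hence to itself, and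
  the weight is definite on matrix polynomials (\<open>weight_inner_self_eq_0\<close>).
\<close>

section \<open>Constant matrices and the right action\<close>

lemma const_mp_mult: "const_mp A ** const_mp B = const_mp (A ** B)"
proof -
  have "(\<Sum>k\<in>S. [:f k:]) = [:\<Sum>k\<in>S. f k:]" for S and f :: "'a::finite \<Rightarrow> complex"
    by (induction S rule: infinite_finite_induct) auto
  then show ?thesis
    by (simp add: const_mp_def matrix_matrix_mult_def vec_eq_iff mult.commute)
qed

lemma const_mp_zero: "const_mp 0 = 0"
  by (simp add: const_mp_def vec_eq_iff)

lemma const_mp_one: "const_mp (mat 1) = mat 1"
  by (simp add: const_mp_def vec_eq_iff mat_def)

lemma matpoly_zero_mult: "(0 :: 'n::finite matpoly) ** Q = 0"
  by (simp add: matrix_matrix_mult_def vec_eq_iff)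

lemma deriv_mp_const_mult: "(deriv_mp ^^ j) (const_mp C ** P) = const_mp C ** (deriv_mp ^^ j) P"
proof -
  have "deriv_mp (const_mp C ** Q) = const_mp C ** deriv_mp Q" for Q
  proof -
    have "deriv_mp (const_mp C) = 0"
      by (simp add: deriv_mp_def const_mp_def vec_eq_iff pderiv_pCons)
    then show ?thesis
      by (simp add: deriv_mp_mult matpoly_zero_mult)
  qed
  then show ?thesis
    by (induction j) auto
qed

lemma matpoly_mult_sum_right: "(B :: 'n::finite matpoly) ** sum f S = (\<Sum>i\<in>S. B ** f i)"
  by (induction S rule: infinite_finite_induct)
    (simp_all add: matrix_matrix_mult_def vec_eq_iff algebra_simps sum.distrib)

lemma act_const_mult: "(const_mp C ** P) \<cdot>\<^sub>r D = const_mp C ** (P \<cdot>\<^sub>r D)"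
  unfolding act_def deriv_mp_const_mult
  by (simp add: matpoly_mult_sum_right matrix_mul_assoc)

section \<open>Coefficients and evaluation\<close>

lemma coeff_mp_diff: "coeff_mp (P - Q) k = coeff_mp P k - coeff_mp Q k"
  by (simp add: coeff_mp_def vec_eq_iff)

lemma coeff_mp_const_mult: "coeff_mp (const_mp C ** P) k = C ** coeff_mp P k"
  by (simp add: coeff_mp_def const_mp_def vec_eq_iff matrix_matrix_mult_def coeff_sum)

lemma matpoly_eqI: "(\<And>k. coeff_mp P k = coeff_mp Q k) \<Longrightarrow> P = Q"
  by (simp add: coeff_mp_def vec_eq_iff poly_eq_iff)

lemma coeff_mp_eventually_zero: "\<exists>d. \<forall>k>d. coeff_mp P k = 0"
proof (intro exI allI impI)
  fix k assume k: "k > Max (range (\<lambda>(i, j). degree (P $ i $ j)))"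
  have "degree (P $ i $ j) < k" for i j
    using k Max_ge[of "range (\<lambda>(i, j). degree (P $ i $ j))" "degree (P $ i $ j)"]
    by (fastforce intro: le_less_trans)
  then show "coeff_mp P k = 0"
    by (simp add: coeff_mp_def vec_eq_iff coeff_eq_0)
qed

lemma monic_mp_coeff_above:
  assumes "monic_mp n P" "k > n"
  shows "coeff_mp P k = 0"
proof -
  have "Max {degree (P $ i $ j) | i j. True} = n"
    using assms(1) by (auto simp: monic_mp_def degree_mp_def split: if_splits)
  moreover have "finite {degree (P $ i $ j) | i j. True}"
    by (rule finite_subset[of _ "range (\<lambda>(i, j). degree (P $ i $ j))"]) auto
  ultimately have "degree (P $ i $ j) \<le> n" for i j
    using Max_ge by blast
  then have "degree (P $ i $ j) < k" for i j
    using assms(2) le_less_trans by blast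
  then show ?thesis
    by (simp add: coeff_mp_def vec_eq_iff coeff_eq_0)
qed

text \<open>
  Evaluation is written with matrix coefficients and real scalars, because the moment
  condition on a weight \<open>W\<close> is about the real multiples \<open>x ^ k *\<^sub>R W x\<close>.
\<close>

lemma eval_mp_expand:
  assumes "\<forall>k>d. coeff_mp P k = 0"
  shows "eval_mp P x = (\<Sum>k\<le>d. x ^ k *\<^sub>R coeff_mp P k)"
proof -
  have "poly (P $ i $ j) (of_real x) = (\<Sum>k\<le>d. x ^ k *\<^sub>R coeff (P $ i $ j) k)" for i j
  proof -
    have "degree (P $ i $ j) \<le> d"
      using assms by (intro degree_le) (simp add: coeff_mp_def vec_eq_iff)
    then have "poly (P $ i $ j) (of_real x) = (\<Sum>k\<le>d. coeff (P $ i $ j) k * of_real x ^ k)"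
      unfolding poly_altdef by (intro sum.mono_neutral_left) (auto simp: coeff_eq_0)
    then show ?thesis
      by (simp add: scaleR_conv_of_real mult.commute)
  qed
  then show ?thesis
    by (simp add: eval_mp_def coeff_mp_def vec_eq_iff)
qed

lemma eval_mp_diff: "eval_mp (P - Q) x = eval_mp P x - eval_mp Q x"
  by (simp add: eval_mp_def vec_eq_iff)

lemma eval_mp_const_mult: "eval_mp (const_mp C ** P) x = C ** eval_mp P x"
  by (simp add: eval_mp_def const_mp_def vec_eq_iff matrix_matrix_mult_def poly_sum)

lemma ctransp_diff: "ctransp (A - B) = ctransp A - ctransp B"
  by (simp add: ctransp_def transpose_def vec_eq_iff)

lemma ctransp_sum_scaleR: "ctransp (\<Sum>k\<in>S. r k *\<^sub>R f k) = (\<Sum>k\<in>S. r k *\<^sub>R ctransp (f k))"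
  by (simp add: ctransp_def transpose_def vec_eq_iff complex_cnj_scaleR)

lemma cmat_mult_diff_left: "((A :: 'n::finite cmat) - B) ** C = A ** C - B ** C"
  by (simp add: matrix_matrix_mult_def vec_eq_iff algebra_simps sum_subtractf)

lemma cmat_mult_diff_right: "(C :: 'n::finite cmat) ** (A - B) = C ** A - C ** B"
  by (simp add: matrix_matrix_mult_def vec_eq_iff algebra_simps sum_subtractf)

lemma bounded_linear_cmat_mult: "bounded_linear (\<lambda>M :: 'n::finite cmat. A ** M ** B)"
proof -
  have "linear (\<lambda>M :: 'n::finite cmat. A ** M ** B)"
    by (intro linearI)
      (simp_all add: matrix_matrix_mult_def vec_eq_iff algebra_simps sum.distrib
        sum_distrib_left scaleR_sum_right sum_distrib_right)
  then show ?thesis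
    by (simp add: linear_conv_bounded_linear)
qed

section \<open>The matrix-valued inner product of a weight\<close>

definition weight_inner ::
  "ereal \<Rightarrow> ereal \<Rightarrow> (real \<Rightarrow> 'n::finite cmat) \<Rightarrow> 'n matpoly \<Rightarrow> 'n matpoly \<Rightarrow> 'n cmat" where
  "weight_inner x0 x1 W P Q =
     set_lebesgue_integral lborel (einterval x0 x1)
       (\<lambda>x. eval_mp P x ** W x ** ctransp (eval_mp Q x))"

text \<open>
  Expanding both polynomials in powers of \<open>x\<close> turns the integrand into a finite sum of images of
  the moment integrands \<open>x ^ (k + l) *\<^sub>R W x\<close> under bounded linear maps \<open>M \<mapsto> A ** M ** B\<close>.
\<close>

lemma weight_inner_integrable:
  assumes "finite_moments x0 x1 W"
  shows "set_integrable lborel (einterval x0 x1)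
           (\<lambda>x. eval_mp P x ** W x ** ctransp (eval_mp Q x))"
proof -
  obtain d e where d: "\<forall>k>d. coeff_mp P k = 0" and e: "\<forall>k>e. coeff_mp Q k = 0"
    using coeff_mp_eventually_zero by metis
  let ?g = "\<lambda>x. \<Sum>k\<le>d. \<Sum>l\<le>e.
      coeff_mp P k ** (x ^ (k + l) *\<^sub>R W x) ** ctransp (coeff_mp Q l)"
  have sum_left: "(\<Sum>k\<in>S. f k) ** B = (\<Sum>k\<in>S. f k ** B)"
    for S :: "nat set" and f :: "nat \<Rightarrow> 'a cmat" and B
    by (induction S rule: infinite_finite_induct)
      (simp_all add: matrix_matrix_mult_def vec_eq_iff algebra_simps sum.distrib)
  have sum_right: "B ** (\<Sum>k\<in>S. f k) = (\<Sum>k\<in>S. B ** f k)"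
    for S :: "nat set" and f :: "nat \<Rightarrow> 'a cmat" and B
    by (induction S rule: infinite_finite_induct)
      (simp_all add: matrix_matrix_mult_def vec_eq_iff algebra_simps sum.distrib)
  have scale: "(r *\<^sub>R X) ** Y ** (s *\<^sub>R Z) = X ** ((r * s) *\<^sub>R Y) ** Z"
    for r s and X Y Z :: "'a cmat"
    by (simp add: matrix_matrix_mult_def vec_eq_iff scaleR_sum_right sum_distrib_left
        sum_distrib_right algebra_simps)
  have "eval_mp P x ** W x ** ctransp (eval_mp Q x) = ?g x" for x
    by (simp add: eval_mp_expand[OF d] eval_mp_expand[OF e] ctransp_sum_scaleR
        sum_left sum_right scale power_add) (rule sum.swap)
  moreover have "set_integrable lborel (einterval x0 x1) ?g"
  proof -
    have "set_integrable lborel (einterval x0 x1)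
        (\<lambda>x. coeff_mp P k ** (x ^ (k + l) *\<^sub>R W x) ** ctransp (coeff_mp Q l))" for k l
    proof -
    have "set_integrable lborel (einterval x0 x1) (\<lambda>x. x ^ (k + l) *\<^sub>R W x)"
      using assms by (auto simp: finite_moments_def)
    from integrable_bounded_linear[OF bounded_linear_cmat_mult this[unfolded set_integrable_def]]
    show ?thesis
      unfolding set_integrable_def
      by (simp add: linear_cmul[OF bounded_linear.linear[OF bounded_linear_cmat_mult]])
    qed
    then show ?thesis
      unfolding set_integrable_def scaleR_sum_right
      by (intro Bochner_Integration.integrable_sum)
  qed
  ultimately show ?thesis
    by simp
qed

lemma weight_inner_diff_left:
  assumes "finite_moments x0 x1 W"
  shows "weight_inner x0 x1 W (P - Q) R = weight_inner x0 x1 W P R - weight_inner x0 x1 W Q R"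
  unfolding weight_inner_def eval_mp_diff cmat_mult_diff_left
  by (intro set_integral_diff weight_inner_integrable assms)

lemma weight_inner_diff_right:
  assumes "finite_moments x0 x1 W"
  shows "weight_inner x0 x1 W R (P - Q) = weight_inner x0 x1 W R P - weight_inner x0 x1 W R Q"
  unfolding weight_inner_def eval_mp_diff ctransp_diff cmat_mult_diff_right
  by (intro set_integral_diff weight_inner_integrable assms)

lemma weight_inner_const_mult_left:
  assumes "finite_moments x0 x1 W"
  shows "weight_inner x0 x1 W (const_mp C ** P) Q = C ** weight_inner x0 x1 W P Q"
proof -
  let ?F = "\<lambda>x. eval_mp P x ** W x ** ctransp (eval_mp Q x)"
  have bl: "bounded_linear (\<lambda>M :: 'a cmat. C ** M)"
    using bounded_linear_cmat_mult[of C "mat 1"] by simp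
  have "C ** weight_inner x0 x1 W P Q
      = (\<integral>x. C ** (indicator (einterval x0 x1) x *\<^sub>R ?F x) \<partial>lborel)"
    unfolding weight_inner_def set_lebesgue_integral_def
    by (rule integral_bounded_linear[OF bl, symmetric])
      (use weight_inner_integrable[OF assms, of P Q] in \<open>simp add: set_integrable_def\<close>)
  then show ?thesis
    by (simp add: weight_inner_def set_lebesgue_integral_def eval_mp_const_mult
        linear_cmul[OF bounded_linear.linear[OF bl]] matrix_mul_assoc)
qed

text \<open>
  The \<open>i\<close>-th diagonal entry of \<open>X ** M ** ctransp X\<close> is the Hermitian form of \<open>M\<close> at the conjugate
  of the \<open>i\<close>-th row of \<open>X\<close>. Working with single diagonal entries reduces the definiteness of the
  matrix-valued inner product to integrals of nonnegative real functions.
\<close>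

lemma positive_definite_row:
  assumes "positive_definite M"
  shows "0 \<le> Re ((X ** M ** ctransp X) $ i $ i)"
    and "Re ((X ** M ** ctransp X) $ i $ i) = 0 \<Longrightarrow> X $ i = 0"
proof -
  define v where "v = (\<chi> j. cnj (X $ i $ j))"
  have eq: "(X ** M ** ctransp X) $ i $ i
      = (\<Sum>k\<in>UNIV. \<Sum>j\<in>UNIV. cnj (v $ k) * M $ k $ j * v $ j)"
    unfolding matrix_matrix_mult_def ctransp_def transpose_def v_def
    by (simp add: sum_distrib_right) (rule sum.swap)
  have pos: "v \<noteq> 0 \<Longrightarrow> 0 < Re ((X ** M ** ctransp X) $ i $ i)"
    using assms unfolding eq positive_definite_def by blast
  have zero: "v = 0 \<Longrightarrow> X $ i = 0"
    by (simp add: v_def vec_eq_iff)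
  show "0 \<le> Re ((X ** M ** ctransp X) $ i $ i)"
    using pos eq by (cases "v = 0") (auto simp: less_imp_le)
  show "Re ((X ** M ** ctransp X) $ i $ i) = 0 \<Longrightarrow> X $ i = 0"
    using pos zero by fastforce
qed

text \<open>
  A nonzero polynomial has only finitely many real zeros, a null set, whereas a nonempty
  open interval has positive measure.
\<close>

lemma AE_zero_on_einterval_imp_poly_eq_0:
  fixes p :: "complex poly"
  assumes "x0 < x1"
    and "AE x in lborel. x \<in> einterval x0 x1 \<longrightarrow> poly p (of_real x) = 0"
  shows "p = 0"
proof (rule ccontr)
  assume "p \<noteq> 0"
  then have "finite {x. poly p (complex_of_real x) = 0}"
    using finite_vimageI[OF poly_roots_finite, of p complex_of_real]
    by (simp add: vimage_def inj_of_real)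
  then have "AE x in lborel. poly p (complex_of_real x) \<noteq> 0"
    by (intro AE_I'[OF finite_imp_null_set_lborel]) auto
  with assms(2) have ae: "AE x in lborel. x \<notin> einterval x0 x1"
    by eventually_elim auto
  obtain a where a: "x0 < ereal a" "ereal a < x1"
    using ereal_dense2[OF assms(1)] by auto
  obtain b where b: "ereal a < ereal b" "ereal b < x1"
    using ereal_dense2[OF a(2)] by auto
  have "{a<..<b} \<subseteq> einterval x0 x1"
    using a b by (auto simp: einterval_def) (meson less_ereal.simps(1) less_trans)+
  then have "AE x in lborel. x \<notin> {a<..<b}"
    using ae by (auto elim!: eventually_mono)
  then have "emeasure lborel {a<..<b} = 0"
    by (subst (asm) AE_iff_measurable[of "{a<..<b}"]) auto
  with b show False
    by simp
qed

text \<open>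
  Each diagonal entry of the integrand has nonnegative real part almost everywhere and integral
  zero, so it vanishes almost everywhere; by positive definiteness the corresponding row of \<open>R\<close>
  then vanishes almost everywhere on the interval, hence identically.
\<close>

lemma weight_inner_self_eq_0:
  assumes W: "weight_matrix x0 x1 W"
    and zero: "weight_inner x0 x1 W R R = 0"
  shows "R = 0"
proof -
  define f where "f = (\<lambda>i x. indicator (einterval x0 x1) x *\<^sub>R
      Re ((eval_mp R x ** W x ** ctransp (eval_mp R x)) $ i $ i))"
  have fm: "finite_moments x0 x1 W" and less: "x0 < x1"
    and pd: "AE x in lborel. x \<in> einterval x0 x1 \<longrightarrow> positive_definite (W x)"
    using W by (auto simp: weight_matrix_def)
  have "R $ i $ j = 0" for i j
  proof -
    have bl: "bounded_linear (\<lambda>M :: 'a cmat. Re (M $ i $ i))"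
      by (intro bounded_linear_compose[OF bounded_linear_Re]
          bounded_linear_compose[OF bounded_linear_vec_nth bounded_linear_vec_nth])
    note int = weight_inner_integrable[OF fm, of R R, unfolded set_integrable_def]
    have f_alt: "f i = (\<lambda>x. Re ((indicator (einterval x0 x1) x *\<^sub>R
        (eval_mp R x ** W x ** ctransp (eval_mp R x))) $ i $ i))"
      by (simp add: f_def fun_eq_iff)
    have "integrable lborel (f i)"
      unfolding f_alt by (rule integrable_bounded_linear[OF bl int])
    moreover have "integral\<^sup>L lborel (f i) = 0"
      unfolding f_alt integral_bounded_linear[OF bl int]
      using zero by (simp add: weight_inner_def set_lebesgue_integral_def)
    moreover have "AE x in lborel. 0 \<le> f i x"
      using pd by eventually_elim (auto simp: f_def indicator_def positive_definite_row)
    ultimately have "AE x in lborel. f i x = 0"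
      using integral_nonneg_eq_0_iff_AE by blast
    with pd have "AE x in lborel. x \<in> einterval x0 x1 \<longrightarrow> poly (R $ i $ j) (of_real x) = 0"
    proof eventually_elim
      case (elim x)
      show ?case
      proof
        assume x: "x \<in> einterval x0 x1"
        with elim have "eval_mp R x $ i = 0"
          by (intro positive_definite_row(2)[of "W x"]) (auto simp: f_def)
        then show "poly (R $ i $ j) (of_real x) = 0"
          by (simp add: eval_mp_def vec_eq_iff)
      qed
    qed
    then show ?thesis
      by (rule AE_zero_on_einterval_imp_poly_eq_0[OF less])
  qed
  then show ?thesis
    by (simp add: vec_eq_iff)
qed

section \<open>Uniqueness of the monic orthogonal polynomials\<close>

text \<open>
  Monic polynomials allow division of the leading term: subtracting \<open>const_mp C ** P m\<close>, where
  \<open>C\<close> is the coefficient of \<open>R\<close> at \<open>m\<close>, lowers the degree and does not change the inner product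
  with \<open>P n\<close>, since \<open>m < n\<close>. Bounding the degree by vanishing coefficients, instead of
  \<open>degree_mp\<close>, includes the zero polynomial without a case distinction.
\<close>

lemma orthogonal_to_lower_degree:
  assumes fm: "finite_moments x0 x1 W"
    and P: "monic_orthogonal_polys x0 x1 W P"
    and "m \<le> n" and "\<forall>k\<ge>m. coeff_mp R k = 0"
  shows "weight_inner x0 x1 W R (P n) = 0"
  using assms(3,4)
proof (induction m arbitrary: R)
  case 0
  then have "R = 0"
    by (intro matpoly_eqI) (simp add: coeff_mp_def vec_eq_iff)
  then show ?case
    using weight_inner_diff_left[OF fm, of 0 0 "P n"] by simp
next
  case (Suc m)
  define C where "C = coeff_mp R m"
  define S where "S = R - const_mp C ** P m"
  have monic: "monic_mp m (P m)" and orth: "weight_inner x0 x1 W (P m) (P n) = 0"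
    using P Suc.prems(1) by (auto simp: monic_orthogonal_polys_def weight_inner_def)
  have "coeff_mp S k = 0" if "m \<le> k" for k
  proof (cases "k = m")
    case True
    then show ?thesis
      using monic by (simp add: S_def C_def coeff_mp_diff coeff_mp_const_mult monic_mp_def)
  next
    case False
    with that show ?thesis
      using monic_mp_coeff_above[OF monic, of k] Suc.prems(2)
      by (simp add: S_def coeff_mp_diff coeff_mp_const_mult)
  qed
  then have "weight_inner x0 x1 W S (P n) = 0"
    using Suc.IH Suc.prems(1) by simp
  then show ?case
    by (simp add: S_def weight_inner_diff_left[OF fm] weight_inner_const_mult_left[OF fm] orth)
qed

theorem monic_orthogonal_polys_unique:
  assumes W: "weight_matrix x0 x1 W"
    and P: "monic_orthogonal_polys x0 x1 W P"
    and Q: "monic_orthogonal_polys x0 x1 W Q"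
  shows "P = Q"
proof
  fix n
  have fm: "finite_moments x0 x1 W"
    using W by (simp add: weight_matrix_def)
  have monic: "monic_mp n (P n)" "monic_mp n (Q n)"
    using P Q by (simp_all add: monic_orthogonal_polys_def)
  have low: "\<forall>k\<ge>n. coeff_mp (P n - Q n) k = 0"
  proof (intro allI impI)
    fix k assume "n \<le> k"
    then show "coeff_mp (P n - Q n) k = 0"
      using monic monic_mp_coeff_above[of n "P n" k] monic_mp_coeff_above[of n "Q n" k]
      by (cases "k = n") (auto simp: coeff_mp_diff monic_mp_def)
  qed
  have "weight_inner x0 x1 W (P n - Q n) (P n - Q n) = 0"
    using orthogonal_to_lower_degree[OF fm P order_refl low]
      orthogonal_to_lower_degree[OF fm Q order_refl low]
    by (simp add: weight_inner_diff_right[OF fm, of "P n - Q n"])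
  then show "P n = Q n"
    using weight_inner_self_eq_0[OF W, of "P n - Q n"] by simp
qed

lemma diffop_algebra_iff:
  assumes "weight_matrix x0 x1 W" "monic_orthogonal_polys x0 x1 W P"
  shows "D \<in> diffop_algebra x0 x1 W \<longleftrightarrow> (\<forall>n. \<exists>\<Lambda>. P n \<cdot>\<^sub>r D = const_mp \<Lambda> ** P n)"
  using assms monic_orthogonal_polys_unique unfolding diffop_algebra_def by blast

section \<open>Darboux transformations\<close>

text \<open>
  A row vector in the left kernel of \<open>A\<close>, repeated in every row, gives a square matrix \<open>C\<close> with
  \<open>C ** A = 0\<close>. So the hypothesis says that the transpose of \<open>A\<close> has trivial kernel.
\<close>

lemma left_inverse_if_left_cancel_zero:
  fixes A :: "'n::finite cmat"
  assumes "\<And>C :: 'n cmat. C ** A = 0 \<Longrightarrow> C = 0"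
  shows "\<exists>B. B ** A = mat 1"
proof -
  have "x = 0" if x: "transpose A *v x = 0" for x
  proof -
    have "(\<chi> i::'n. x) ** A = 0"
      using x by (simp add: matrix_matrix_mult_def matrix_vector_mult_def transpose_def
          vec_eq_iff mult.commute)
    then have "(\<chi> i::'n. x) = 0"
      by (rule assms)
    then show "x = 0"
      by (simp add: vec_eq_iff)
  qed
  then obtain B where "B ** transpose A = mat 1"
    using matrix_left_invertible_ker by blast
  then have "A ** transpose B = mat 1"
    by (metis matrix_transpose_mul transpose_mat transpose_transpose)
  then show ?thesis
    using matrix_left_right_inverse by blast
qed

text \<open>
  The zero polynomial is the only one of degree \<open>-\<infinity>\<close>, so a degree-preserving operator
  annihilates nothing else.
\<close>

lemma degree_preserving_act_eq_0:
  assumes "degree_preserving V" "P \<cdot>\<^sub>r V = 0"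
  shows "P = 0"
  using assms unfolding degree_preserving_def
  by (metis MInfty_neq_ereal(1) degree_mp_def)

text \<open>
  Left multiples \<open>const_mp C ** P\<close> of the monic polynomial \<open>P\<close> have \<open>C\<close> as coefficient at \<open>n\<close>, so
  they are nonzero for \<open>C \<noteq> 0\<close> and cannot be annihilated by \<open>V\<close>.
\<close>

lemma degree_preserving_leading_invertible:
  assumes V: "degree_preserving V" and P: "monic_mp n P"
    and act: "P \<cdot>\<^sub>r V = const_mp A ** Q"
  shows "\<exists>B. B ** A = mat 1"
proof (rule left_inverse_if_left_cancel_zero)
  fix C :: "'a cmat" assume "C ** A = 0"
  then have "(const_mp C ** P) \<cdot>\<^sub>r V = 0"
    by (simp add: act_const_mult act matrix_mul_assoc const_mp_mult const_mp_zero
        matpoly_zero_mult)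
  then have "const_mp C ** P = 0"
    using degree_preserving_act_eq_0[OF V] by blast
  moreover have "coeff_mp (const_mp C ** P) n = C"
    using P by (simp add: coeff_mp_const_mult monic_mp_def)
  ultimately show "C = 0"
    by (simp add: coeff_mp_def vec_eq_iff)
qed

theorem proposition3p9:
  fixes x0 x1 :: ereal
    and W Wt :: "real \<Rightarrow> complex ^ 'n::finite ^ 'n"
    and P Pt :: "nat \<Rightarrow> 'n matpoly"
    and D V N :: "'n diffop"
    and A :: "nat \<Rightarrow> complex ^ 'n ^ 'n"
  assumes "weight_matrix x0 x1 W"
    and "weight_matrix x0 x1 Wt"
    and "monic_orthogonal_polys x0 x1 W P"
    and "monic_orthogonal_polys x0 x1 Wt Pt"
    and "D = V \<star> N"
    and "D \<in> diffop_algebra x0 x1 W"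
    and "degree_preserving V"
    and "degree_preserving N"
    and "\<And>n. P n \<cdot>\<^sub>r V = const_mp (A n) ** Pt n"
  shows "{V \<star> E \<star> N | E. E \<in> diffop_algebra x0 x1 Wt} \<subseteq> diffop_algebra x0 x1 W
       \<and> {N \<star> E \<star> V | E. E \<in> diffop_algebra x0 x1 W} \<subseteq> diffop_algebra x0 x1 Wt"
proof -
  note W_iff = diffop_algebra_iff[OF assms(1,3)]
  note Wt_iff = diffop_algebra_iff[OF assms(2,4)]
  note V = assms(9)
  have "\<exists>B. Pt n \<cdot>\<^sub>r N = const_mp B ** P n" for n
  proof -
    obtain L where L: "(P n \<cdot>\<^sub>r V) \<cdot>\<^sub>r N = const_mp L ** P n"
      using assms(5,6) unfolding W_iff by (metis act_op_mult)
    have "monic_mp n (P n)"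
      using assms(3) by (simp add: monic_orthogonal_polys_def)
    then obtain A' where A': "A' ** A n = mat 1"
      using degree_preserving_leading_invertible[OF assms(7) _ V] by blast
    have "Pt n \<cdot>\<^sub>r N = (const_mp A' ** (P n \<cdot>\<^sub>r V)) \<cdot>\<^sub>r N"
      by (simp add: V matrix_mul_assoc const_mp_mult A' const_mp_one)
    also have "\<dots> = const_mp (A' ** L) ** P n"
      by (simp add: act_const_mult L matrix_mul_assoc const_mp_mult)
    finally show ?thesis
      by blast
  qed
  then obtain B where N: "\<And>n. Pt n \<cdot>\<^sub>r N = const_mp (B n) ** P n"
    by metis
  have "V \<star> E \<star> N \<in> diffop_algebra x0 x1 W" if E: "E \<in> diffop_algebra x0 x1 Wt" for E
    unfolding W_iff
  proof
    fix n
    obtain L where "Pt n \<cdot>\<^sub>r E = const_mp L ** Pt n"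
      using E unfolding Wt_iff by blast
    then have "P n \<cdot>\<^sub>r (V \<star> E \<star> N) = const_mp (A n ** L ** B n) ** P n"
      by (simp add: act_op_mult V N act_const_mult matrix_mul_assoc const_mp_mult)
    then show "\<exists>L. P n \<cdot>\<^sub>r (V \<star> E \<star> N) = const_mp L ** P n"
      by blast
  qed
  moreover have "N \<star> E \<star> V \<in> diffop_algebra x0 x1 Wt" if E: "E \<in> diffop_algebra x0 x1 W" for E
    unfolding Wt_iff
  proof
    fix n
    obtain L where "P n \<cdot>\<^sub>r E = const_mp L ** P n"
      using E unfolding W_iff by blast
    then have "Pt n \<cdot>\<^sub>r (N \<star> E \<star> V) = const_mp (B n ** L ** A n) ** Pt n"
      by (simp add: act_op_mult V N act_const_mult matrix_mul_assoc const_mp_mult)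
    then show "\<exists>L. Pt n \<cdot>\<^sub>r (N \<star> E \<star> V) = const_mp L ** Pt n"
      by blast
  qed
  ultimately show ?thesis
    by blast
qed

end
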